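(* Every codimension one foliation $\mathscr{F}$ of degree $0$ on $\mathbf{C}\mathbf{P}(n)$ is associated with a pencil of hyperplanes, i.e. it has a first integral $\frac{\ell_1}{\ell_2}$ where $\ell_1$ and $\ell_2$ are independent linear forms. In particular, $\mathscr{F}$ is an $\mathscr{L}$-foliation.
   Context: A codimension one foliation $\mathscr{F}$ of degree $\nu$ on $\mathbf{C}\mathbf{P}(n)$ is given in homogeneous coordinates by a $1$-form $\omega=\sum_{k=0}^nA_kdz_k$ on $\mathbf{C}^{n+1}$, with $A_k$ homogeneous polynomials of degree $\nu+1$, $\omega\wedge d\omega=0$, $\sum z_kA_k=0$, and $\{A_0=\dots=A_n=0\}$ of codimension $\geq2$. Let $\chi(\mathbf{C}\mathbf{P}(n))$ be the Lie algebra of holomorphic vector fields on $\mathbf{C}\mathbf{P}(n)$. $\mathscr{F}$ is an $\mathscr{L}$-foliation if there is a Lie subalgebra $\mathscr{L}\subset\chi(\mathbf{C}\mathbf{P}(n))$ such that, for generic $z$, $\mathscr{L}(z)=\{X(z):X\in\mathscr{L}\}$ is the tangent space at $z$ to the leaf of $\mathscr{F}$ (so it has dimension $n-1$). *)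

theory Defs
  imports "HOL-Analysis.Analysis" "HOL-Library.Extended_Nat"
begin

(* Throughout, CARD('n) = n + 1: the index type 'n labels the homogeneous
   coordinates z_0, ..., z_n of CP(n), and complex^'n is C^(n+1). *)

section \<open>Polynomials and algebraic sets\<close>

(* Polynomials over C are identified with the functions they induce on C^(n+1). *)

definition monom_fun :: "('n::finite \<Rightarrow> nat) \<Rightarrow> complex^'n \<Rightarrow> complex" where
  "monom_fun m z = (\<Prod>i\<in>UNIV. (z $ i) ^ m i)"

definition polynomial_fun :: "(complex^'n::finite \<Rightarrow> complex) \<Rightarrow> bool" where
  "polynomial_fun p \<longleftrightarrow>
     (\<exists>M c. finite M \<and> p = (\<lambda>z. \<Sum>m\<in>M. c m * monom_fun m z))"

definition homogeneous_fun :: "nat \<Rightarrow> (complex^'n::finite \<Rightarrow> complex) \<Rightarrow> bool" where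
  "homogeneous_fun d p \<longleftrightarrow>
     (\<exists>M c. finite M \<and> (\<forall>m\<in>M. (\<Sum>i\<in>UNIV. m i) = d) \<and>
            p = (\<lambda>z. \<Sum>m\<in>M. c m * monom_fun m z))"

definition zero_locus :: "(complex^'n::finite \<Rightarrow> complex) set \<Rightarrow> (complex^'n) set" where
  "zero_locus S = {z. \<forall>p\<in>S. p z = 0}"

definition zariski_closed :: "(complex^'n::finite) set \<Rightarrow> bool" where
  "zariski_closed V \<longleftrightarrow> (\<exists>S. (\<forall>p\<in>S. polynomial_fun p) \<and> V = zero_locus S)"

definition irreducible_closed :: "(complex^'n::finite) set \<Rightarrow> bool" where
  "irreducible_closed V \<longleftrightarrow> zariski_closed V \<and> V \<noteq> {} \<and>
     (\<forall>B C. zariski_closed B \<and> zariski_closed C \<and> V = B \<union> C \<longrightarrow> V = B \<or> V = C)"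

definition irreducible_chain :: "(complex^'n::finite) set \<Rightarrow> nat \<Rightarrow> bool" where
  "irreducible_chain W r \<longleftrightarrow>
     (\<exists>f::nat \<Rightarrow> (complex^'n) set. f 0 = W \<and> (\<forall>i\<le>r. irreducible_closed (f i)) \<and>
        (\<forall>i<r. f i \<subset> f (Suc i)))"

(* Krull codimension in C^(n+1) for the Zariski topology; the empty set has
   codimension infinity. *)
definition codimension :: "(complex^'n::finite) set \<Rightarrow> enat" where
  "codimension Z =
     (INF W\<in>{W. irreducible_closed W \<and> W \<subseteq> Z}. SUP r\<in>{r. irreducible_chain W r}. enat r)"

(* Zariski closed subsets of CP(n) are represented by their cones in C^(n+1). *)
definition projective_closed :: "(complex^'n::finite) set \<Rightarrow> bool" where
  "projective_closed V \<longleftrightarrow>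
     (\<exists>S. (\<forall>p\<in>S. \<exists>d. homogeneous_fun d p) \<and> V = zero_locus S)"

(* P holds outside a proper Zariski closed subset of CP(n). *)
definition for_generic_point :: "(complex^'n::finite \<Rightarrow> bool) \<Rightarrow> bool" where
  "for_generic_point P \<longleftrightarrow>
     (\<exists>V. projective_closed V \<and> (\<exists>z. z \<noteq> 0 \<and> z \<notin> V) \<and> (\<forall>z. z \<noteq> 0 \<and> z \<notin> V \<longrightarrow> P z))"


section \<open>Differential calculus on complex vector spaces\<close>

definition holomorphic_fun_on :: "(complex^'n::finite \<Rightarrow> complex) \<Rightarrow> (complex^'n) set \<Rightarrow> bool" where
  "holomorphic_fun_on f S \<longleftrightarrow>
     (\<forall>z\<in>S. \<exists>D. Vector_Spaces.linear (*s) (*) D \<and> (f has_derivative D) (at z within S))"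

(* df(z)(u) for holomorphic f *)
definition differential :: "(complex^'n::finite \<Rightarrow> complex) \<Rightarrow> complex^'n \<Rightarrow> complex^'n \<Rightarrow> complex" where
  "differential f z u = deriv (\<lambda>t. f (z + t *s u)) 0"

(* omega = sum_k A_k dz_k, as the linear functional omega(z) on C^(n+1) *)
definition one_form :: "('n::finite \<Rightarrow> complex^'n \<Rightarrow> complex) \<Rightarrow> complex^'n \<Rightarrow> complex^'n \<Rightarrow> complex" where
  "one_form A z v = (\<Sum>k\<in>UNIV. A k z * v $ k)"

definition ext_deriv ::
    "(complex^'n::finite \<Rightarrow> complex^'n \<Rightarrow> complex) \<Rightarrow> complex^'n \<Rightarrow> complex^'n \<Rightarrow> complex^'n \<Rightarrow> complex" where
  "ext_deriv \<omega> z u v = differential (\<lambda>x. \<omega> x v) z u - differential (\<lambda>x. \<omega> x u) z v"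

definition wedge11 ::
    "(complex^'n::finite \<Rightarrow> complex) \<Rightarrow> (complex^'n \<Rightarrow> complex) \<Rightarrow> complex^'n \<Rightarrow> complex^'n \<Rightarrow> complex" where
  "wedge11 \<alpha> \<beta> u v = \<alpha> u * \<beta> v - \<alpha> v * \<beta> u"

definition wedge12 ::
    "(complex^'n::finite \<Rightarrow> complex) \<Rightarrow> (complex^'n \<Rightarrow> complex^'n \<Rightarrow> complex) \<Rightarrow>
     complex^'n \<Rightarrow> complex^'n \<Rightarrow> complex^'n \<Rightarrow> complex" where
  "wedge12 \<alpha> \<beta> u v w = \<alpha> u * \<beta> v w - \<alpha> v * \<beta> u w + \<alpha> w * \<beta> u v"


section \<open>Codimension one foliations of CP(n)\<close>

definition singular_set :: "('n::finite \<Rightarrow> complex^'n \<Rightarrow> complex) \<Rightarrow> (complex^'n) set" where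
  "singular_set A = {z. \<forall>k. A k z = 0}"

definition codim_one_foliation :: "nat \<Rightarrow> ('n::finite \<Rightarrow> complex^'n \<Rightarrow> complex) \<Rightarrow> bool" where
  "codim_one_foliation \<nu> A \<longleftrightarrow>
     (\<forall>k. homogeneous_fun (\<nu> + 1) (A k)) \<and>
     (\<forall>z u v w. wedge12 (one_form A z) (ext_deriv (one_form A) z) u v w = 0) \<and>
     (\<forall>z. (\<Sum>k\<in>UNIV. z $ k * A k z) = 0) \<and>
     codimension (singular_set A) \<ge> 2"

(* A nonconstant holomorphic function f on U is constant on the leaves
   (the integral manifolds of ker omega) iff omega and df are everywhere
   proportional, i.e. omega /\ df = 0. *)
definition first_integral_on ::
    "('n::finite \<Rightarrow> complex^'n \<Rightarrow> complex) \<Rightarrow> (complex^'n \<Rightarrow> complex) \<Rightarrow> (complex^'n) set \<Rightarrow> bool" where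
  "first_integral_on A f U \<longleftrightarrow>
     holomorphic_fun_on f U \<and> \<not> f constant_on U \<and>
     (\<forall>z\<in>U. \<forall>u v. wedge11 (one_form A z) (differential f z) u v = 0)"

definition linear_form :: "(complex^'n::finite \<Rightarrow> complex) \<Rightarrow> bool" where
  "linear_form l \<longleftrightarrow> Vector_Spaces.linear (*s) (*) l"

definition independent_forms :: "(complex^'n::finite \<Rightarrow> complex) \<Rightarrow> (complex^'n \<Rightarrow> complex) \<Rightarrow> bool" where
  "independent_forms l1 l2 \<longleftrightarrow>
     (\<forall>a b. (\<forall>z. a * l1 z + b * l2 z = 0) \<longrightarrow> a = 0 \<and> b = 0)"


section \<open>Holomorphic vector fields on CP(n)\<close>

(* The chart {z_k \<noteq> 0} of CP(n), with affine coordinates z_j / z_k, is the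
   affine hyperplane w_k = 1 of C^(n+1), whose tangent space is v_k = 0. *)
definition affine_chart :: "'n::finite \<Rightarrow> (complex^'n) set" where
  "affine_chart k = {w. w $ k = 1}"

definition to_chart :: "'n::finite \<Rightarrow> complex^'n \<Rightarrow> complex^'n" where
  "to_chart k z = (1 / z $ k) *s z"

(* the derivative of to_chart k at w, applied to v *)
definition to_chart_deriv :: "'n::finite \<Rightarrow> complex^'n \<Rightarrow> complex^'n \<Rightarrow> complex^'n" where
  "to_chart_deriv k w v = (1 / w $ k) *s v - (v $ k / (w $ k)\<^sup>2) *s w"

(* A vector field on CP(n) is the family of its expressions X k in the n + 1
   affine charts, which must correspond under the changes of chart.  The value
   of X k off the chart is normalised to 0, so that equality of families is
   equality of vector fields. *)
definition holomorphic_vector_fields :: "('n::finite \<Rightarrow> complex^'n \<Rightarrow> complex^'n) set" where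
  "holomorphic_vector_fields =
     {X. (\<forall>k. \<forall>w\<in>affine_chart k. X k w $ k = 0) \<and>
         (\<forall>k w. w \<notin> affine_chart k \<longrightarrow> X k w = 0) \<and>
         (\<forall>k i. holomorphic_fun_on (\<lambda>w. X k w $ i) (affine_chart k)) \<and>
         (\<forall>j k. \<forall>w\<in>affine_chart j. w $ k \<noteq> 0 \<longrightarrow>
            X k (to_chart k w) = to_chart_deriv k w (X j w))}"

(* The differentials only involve values on the chart, since X k w and Y k w
   are tangent to it. *)
definition lie_bracket ::
    "('n::finite \<Rightarrow> complex^'n \<Rightarrow> complex^'n) \<Rightarrow> ('n \<Rightarrow> complex^'n \<Rightarrow> complex^'n) \<Rightarrow>
     'n \<Rightarrow> complex^'n \<Rightarrow> complex^'n" where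
  "lie_bracket X Y k w =
     (\<chi> i. differential (\<lambda>x. Y k x $ i) w (X k w) - differential (\<lambda>x. X k x $ i) w (Y k w))"

definition lie_subalgebra :: "('n::finite \<Rightarrow> complex^'n \<Rightarrow> complex^'n) set \<Rightarrow> bool" where
  "lie_subalgebra L \<longleftrightarrow>
     L \<subseteq> holomorphic_vector_fields \<and>
     (\<lambda>k w. 0) \<in> L \<and>
     (\<forall>X\<in>L. \<forall>Y\<in>L. (\<lambda>k w. X k w + Y k w) \<in> L) \<and>
     (\<forall>c. \<forall>X\<in>L. (\<lambda>k w. c *s X k w) \<in> L) \<and>
     (\<forall>X\<in>L. \<forall>Y\<in>L. lie_bracket X Y \<in> L)"

(* Tangent space, in the chart k, to the leaf through the nonsingular point w:
   the kernel of the restriction of omega(w) to the tangent space of the chart. *)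
definition leaf_tangent_space ::
    "('n::finite \<Rightarrow> complex^'n \<Rightarrow> complex) \<Rightarrow> 'n \<Rightarrow> complex^'n \<Rightarrow> (complex^'n) set" where
  "leaf_tangent_space A k w = {v. v $ k = 0 \<and> one_form A w v = 0}"

definition L_foliation :: "('n::finite \<Rightarrow> complex^'n \<Rightarrow> complex) \<Rightarrow> bool" where
  "L_foliation A \<longleftrightarrow>
     (\<exists>L. lie_subalgebra L \<and>
        for_generic_point (\<lambda>z. z \<notin> singular_set A \<and>
          (\<forall>k. z $ k \<noteq> 0 \<longrightarrow>
             {X k (to_chart k z) | X. X \<in> L} = leaf_tangent_space A k (to_chart k z))))"

end

theory Submission
  imports Defs
begin

text \<open>
  In degree \<open>0\<close> the coefficients of \<open>\<omega>\<close> are linear forms, so \<open>\<omega>(z)(v)\<close> is a bilinear form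
  \<open>B(z,v)\<close>, and contraction with the radial field makes it alternating. Hence
  \<open>d\<omega> = 2B\<close>, and \<open>\<omega> \<and> d\<omega> = 0\<close> becomes the Pluecker relation
  \[ B(z,u) B(v,w) - B(z,v) B(u,w) + B(z,w) B(u,v) = 0, \]
  which says that \<open>B\<close> is decomposable. Concretely, \<open>B \<noteq> 0\<close> because otherwise the singular set
  would be the whole (irreducible) space, of codimension \<open>0\<close>; if \<open>B(p,q) \<noteq> 0\<close>, the relation
  expresses \<open>B(p,q) B\<close> as the wedge product of the linear forms \<open>B(\<cdot>,p)\<close> and \<open>B(\<cdot>,q)\<close>. Their
  quotient is the first integral.

  For the Lie algebra, let \<open>R\<close> be the singular set, which is the radical of \<open>B\<close>, and take the
  vector fields of \<open>CP(n)\<close> induced by the linear fields \<open>z \<mapsto> M z\<close> with \<open>M\<close> of range inside \<open>R\<close>.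
  These matrices are closed under commutators. They are tangent to the foliation since
  \<open>B(z, M z) = 0\<close>. Conversely, at a point \<open>w \<notin> R\<close> the Pluecker relation gives
  \<open>ker B(w,\<cdot>) = R + \<complex> w\<close>, so that every leaf direction is, modulo the radial direction, a vector of
  \<open>R\<close>, and each vector of \<open>R\<close> is \<open>M w\<close> for some such \<open>M\<close> of rank one.
\<close>

section \<open>Irreducibility of the affine space\<close>

lemma polynomial_fun_on_line:
  fixes p :: "complex^'n::finite \<Rightarrow> complex"
  assumes "polynomial_fun p"
  shows "\<exists>P. \<forall>t. p (x + t *s u) = poly P t"
proof -
  obtain M c where p: "p = (\<lambda>z. \<Sum>m\<in>M. c m * monom_fun m z)"
    using assms unfolding polynomial_fun_def by blast
  have "p (x + t *s u) = poly (\<Sum>m\<in>M. smult (c m) (\<Prod>i\<in>UNIV. [:x $ i, u $ i:] ^ m i)) t" for t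
    by (simp add: p monom_fun_def poly_sum poly_prod)
  then show ?thesis by blast
qed

text \<open>
  Two polynomials that are nonzero at \<open>x\<close> and at \<open>y\<close> respectively both restrict to nonzero
  polynomials in one variable on the line through \<open>x\<close> and \<open>y\<close>, and this line has more points than
  their product has roots.
\<close>
lemma irreducible_closed_UNIV: "irreducible_closed (UNIV :: (complex^'n::finite) set)"
proof -
  have "zariski_closed (UNIV :: (complex^'n) set)"
    unfolding zariski_closed_def zero_locus_def by (intro exI[of _ "{}"]) auto
  moreover have "UNIV = B \<or> UNIV = C"
    if BC: "zariski_closed B" "zariski_closed C" "UNIV = B \<union> C" for B C :: "(complex^'n) set"
  proof (rule ccontr)
    assume contr: "\<not> ?thesis"
    obtain S T where S: "\<forall>p\<in>S. polynomial_fun p" "B = zero_locus S"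
      and T: "\<forall>p\<in>T. polynomial_fun p" "C = zero_locus T"
      using BC unfolding zariski_closed_def by blast
    obtain x y where "x \<notin> B" "y \<notin> C" using contr by blast
    then obtain p q where p: "p \<in> S" "p x \<noteq> 0" and q: "q \<in> T" "q y \<noteq> 0"
      using S T unfolding zero_locus_def by auto
    have pq: "p z = 0 \<or> q z = 0" for z
      using BC(3) S(2) T(2) p(1) q(1) unfolding zero_locus_def by blast
    obtain P Q where P: "\<And>t. p (x + t *s (y - x)) = poly P t"
      and Q: "\<And>t. q (x + t *s (y - x)) = poly Q t"
      using polynomial_fun_on_line S(1) T(1) p(1) q(1) by metis
    have "poly P 0 \<noteq> 0" "poly Q 1 \<noteq> 0"
      using P[of 0] Q[of 1] p(2) q(2) by simp_all
    then have "P * Q \<noteq> 0" by auto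
    moreover have "poly (P * Q) t = 0" for t
      using pq[of "x + t *s (y - x)"] unfolding P Q by simp
    ultimately show False using poly_all_0_iff_0 by blast
  qed
  ultimately show ?thesis unfolding irreducible_closed_def by blast
qed

lemma codimension_UNIV: "codimension (UNIV :: (complex^'n::finite) set) = 0"
proof -
  have "r = 0" if chain: "irreducible_chain (UNIV :: (complex^'n) set) r" for r
  proof (rule ccontr)
    assume "r \<noteq> 0"
    obtain f where "f 0 = (UNIV :: (complex^'n) set)" "\<forall>i<r. f i \<subset> f (Suc i)"
      using chain unfolding irreducible_chain_def by blast
    with \<open>r \<noteq> 0\<close> have "(UNIV :: (complex^'n) set) \<subset> f (Suc 0)" by (metis not_gr_zero)
    then show False by blast
  qed
  then have "(SUP r\<in>{r. irreducible_chain (UNIV :: (complex^'n) set) r}. enat r) \<le> 0"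
    by (intro SUP_least) (auto simp: zero_enat_def)
  moreover have "codimension (UNIV :: (complex^'n) set)
      \<le> (SUP r\<in>{r. irreducible_chain (UNIV :: (complex^'n) set) r}. enat r)"
    unfolding codimension_def by (rule INF_lower) (simp add: irreducible_closed_UNIV)
  ultimately show ?thesis by simp
qed

section \<open>Linear forms and their differentials\<close>

lemma linear_form_iff:
  "linear_form l \<longleftrightarrow> (\<forall>x y. l (x + y) = l x + l y) \<and> (\<forall>c x. l (c *s x) = c * l x)"
proof -
  have "vector_space ((*s) :: complex \<Rightarrow> complex^'a \<Rightarrow> complex^'a)"
    "vector_space ((*) :: complex \<Rightarrow> complex \<Rightarrow> complex)"
    by (unfold_locales, simp_all add: vec_eq_iff algebra_simps)+
  then show ?thesis
    unfolding linear_form_def Vector_Spaces.linear_def module_hom_def module_hom_axioms_def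
    by (auto simp: vector_space_def module_def)
qed

lemma linear_form_sum:
  assumes "\<And>i. i \<in> I \<Longrightarrow> linear_form (f i)"
  shows "linear_form (\<lambda>z. \<Sum>i\<in>I. c i * f i z)"
  using assms by (simp add: linear_form_iff sum.distrib sum_distrib_left algebra_simps)

lemma linear_form_coordinate: "linear_form (\<lambda>z. z $ i)"
  by (simp add: linear_form_iff)

lemma homogeneous_fun_1_imp_linear_form:
  assumes "homogeneous_fun 1 p"
  shows "linear_form p"
proof -
  obtain M c where M: "\<And>m. m \<in> M \<Longrightarrow> (\<Sum>i\<in>UNIV. m i) = (1::nat)"
    and p: "p = (\<lambda>z. \<Sum>m\<in>M. c m * monom_fun m z)"
    using assms unfolding homogeneous_fun_def by blast
  have "linear_form (monom_fun m)" if m: "m \<in> M" for m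
  proof -
    obtain i where i: "m i = 1" "\<And>j. j \<noteq> i \<Longrightarrow> m j = 0"
      using M[OF m] by (auto simp: sum_eq_Suc0_iff)
    have "monom_fun m z = z $ i" for z
    proof -
      have "monom_fun m z = (\<Prod>j\<in>UNIV. if j = i then z $ j else 1)"
        unfolding monom_fun_def by (rule prod.cong) (auto simp: i)
      then show ?thesis by simp
    qed
    then have "monom_fun m = (\<lambda>z. z $ i)" by (rule ext)
    then show ?thesis by (simp only: linear_form_coordinate)
  qed
  then show ?thesis unfolding p by (rule linear_form_sum)
qed

lemma linear_form_has_derivative:
  fixes l :: "complex^'n::finite \<Rightarrow> complex"
  assumes "linear_form l"
  shows "(l has_derivative l) F"
proof -
  have scaleR: "r *\<^sub>R x = complex_of_real r *s x" for r and x :: "complex^'n"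
    by (simp add: vec_eq_iff scaleR_conv_of_real[where 'a = complex])
  have "linear l"
    by (rule linearI)
      (use assms in \<open>auto simp: linear_form_iff scaleR scaleR_conv_of_real[where 'a = complex]\<close>)
  then show ?thesis
    by (intro bounded_linear_imp_has_derivative) (simp add: linear_linear)
qed

lemma linear_form_line:
  assumes "linear_form l"
  shows "l (z + t *s u) = l z + t * l u"
  using assms by (simp add: linear_form_iff)

lemma differential_linear_form:
  assumes "linear_form l"
  shows "differential l z u = l u"
  unfolding differential_def linear_form_line[OF assms]
  by (rule DERIV_imp_deriv) (auto intro!: derivative_eq_intros)

section \<open>Quotients of linear forms\<close>

lemma holomorphic_fun_on_quotient:
  assumes "linear_form l1" "linear_form l2"
  shows "holomorphic_fun_on (\<lambda>z. l1 z / l2 z) {z. l2 z \<noteq> 0}"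
  unfolding holomorphic_fun_on_def
proof (intro ballI exI conjI)
  fix z assume "z \<in> {z. l2 z \<noteq> 0}"
  then have z: "l2 z \<noteq> 0" by simp
  show "((\<lambda>z. l1 z / l2 z) has_derivative
      (\<lambda>h. - l1 z * (inverse (l2 z) * l2 h * inverse (l2 z)) + l1 h / l2 z))
      (at z within {z. l2 z \<noteq> 0})"
    by (intro has_derivative_divide linear_form_has_derivative assms z)
  show "Vector_Spaces.linear (*s) (*)
      (\<lambda>h. - l1 z * (inverse (l2 z) * l2 h * inverse (l2 z)) + l1 h / l2 z)"
    using assms z unfolding linear_form_def[symmetric] linear_form_iff
    by (simp add: field_simps)
qed

lemma differential_quotient:
  assumes "linear_form l1" "linear_form l2" "l2 z \<noteq> 0"
  shows "differential (\<lambda>x. l1 x / l2 x) z u = (l1 u * l2 z - l1 z * l2 u) / (l2 z)\<^sup>2"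
  unfolding differential_def linear_form_line[OF assms(1)] linear_form_line[OF assms(2)]
  by (rule DERIV_imp_deriv)
    (use assms(3) in \<open>auto intro!: derivative_eq_intros simp: power2_eq_square\<close>)

section \<open>Projective vector fields induced by matrices\<close>

text \<open>
  The field on projective space induced by \<open>z \<mapsto> M z\<close>. On the chart \<open>w $ k = 1\<close> the
  projection along the radial direction onto the tangent space is \<open>v \<mapsto> v - v $ k w\<close>.
\<close>
definition matrix_field :: "complex^'n^'n \<Rightarrow> 'n::finite \<Rightarrow> complex^'n \<Rightarrow> complex^'n" where
  "matrix_field M k w = (if w $ k = 1 then M *v w - ((M *v w) $ k) *s w else 0)"

lemma linear_form_matrix_row: "linear_form (\<lambda>w. (M *v w) $ i)"
  by (simp add: linear_form_iff matrix_vector_right_distrib vector_scalar_commute)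

text \<open>
  The compatibility between the charts holds because the derivative of the chart map kills the
  radial direction, so that it sees only \<open>M w\<close>.
\<close>
lemma matrix_field_holomorphic:
  "matrix_field (M :: complex^'n::finite^'n) \<in> holomorphic_vector_fields"
proof -
  have holo: "holomorphic_fun_on (\<lambda>w. matrix_field M k w $ i) (affine_chart k)" for k i
    unfolding holomorphic_fun_on_def
  proof (intro ballI exI conjI)
    fix w :: "complex^'n" assume w: "w \<in> affine_chart k"
    have "((\<lambda>w. (M *v w) $ i - (M *v w) $ k * w $ i) has_derivative
        (\<lambda>h. (M *v h) $ i - ((M *v w) $ k * h $ i + (M *v h) $ k * w $ i)))
        (at w within affine_chart k)"
      by (intro has_derivative_diff has_derivative_mult linear_form_has_derivative
          linear_form_matrix_row linear_form_coordinate)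
    then show "((\<lambda>w. matrix_field M k w $ i) has_derivative
        (\<lambda>h. (M *v h) $ i - ((M *v w) $ k * h $ i + (M *v h) $ k * w $ i)))
        (at w within affine_chart k)"
      by (rule has_derivative_transform[OF w, rotated])
        (auto simp: matrix_field_def affine_chart_def)
    show "Vector_Spaces.linear (*s) (*)
        (\<lambda>h. (M *v h) $ i - ((M *v w) $ k * h $ i + (M *v h) $ k * w $ i))"
      unfolding linear_form_def[symmetric] linear_form_iff
      by (simp add: matrix_vector_right_distrib vector_scalar_commute algebra_simps)
  qed
  have "matrix_field M k (to_chart k w) = to_chart_deriv k w (matrix_field M j w)"
    if "w \<in> affine_chart j" "w $ k \<noteq> 0" for j k w
    using that
    by (simp add: matrix_field_def affine_chart_def to_chart_def to_chart_deriv_def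
        vector_scalar_commute vec_eq_iff field_simps power2_eq_square)
  with holo show ?thesis
    unfolding holomorphic_vector_fields_def
    by (auto simp: matrix_field_def affine_chart_def)
qed

lemma differential_matrix_field:
  assumes "w $ k = 1" "u $ k = 0"
  shows "differential (\<lambda>x. matrix_field M k x $ i) w u =
    (M *v u) $ i - (M *v w) $ k * u $ i - (M *v u) $ k * w $ i"
proof -
  \<comment> \<open>Since \<open>u\<close> is tangent to the chart, the line stays in it.\<close>
  have "(\<lambda>t. matrix_field M k (w + t *s u) $ i) =
      (\<lambda>t. (M *v w) $ i + t * (M *v u) $ i
         - ((M *v w) $ k + t * (M *v u) $ k) * (w $ i + t * u $ i))"
    using assms
    by (simp add: matrix_field_def matrix_vector_right_distrib vector_scalar_commute algebra_simps)
  then show ?thesis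
    unfolding differential_def
    by (simp only:, intro DERIV_imp_deriv)
      (auto intro!: derivative_eq_intros simp: algebra_simps)
qed

text \<open>
  The sign is the usual one for linear fields. The terms in which both matrices act on \<open>w\<close>
  separately are symmetric in the two matrices and cancel.
\<close>
lemma lie_bracket_matrix_field:
  fixes M N :: "complex^'n::finite^'n"
  shows "lie_bracket (matrix_field M) (matrix_field N) = matrix_field (N ** M - M ** N)"
proof (intro ext)
  fix k and w :: "complex^'n"
  show "lie_bracket (matrix_field M) (matrix_field N) k w = matrix_field (N ** M - M ** N) k w"
  proof (cases "w $ k = 1")
    case True
    have tangent: "matrix_field M k w $ k = 0" for M :: "complex^'n^'n"
      using True by (simp add: matrix_field_def)
    show ?thesis
      unfolding lie_bracket_def differential_matrix_field[OF True tangent]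
      using True
      by (simp add: matrix_field_def vec_eq_iff matrix_vector_mult_diff_distrib
          matrix_vector_mult_diff_rdistrib vector_scalar_commute
          matrix_vector_mul_assoc[symmetric] algebra_simps)
  next
    case False
    then show ?thesis
      by (simp add: lie_bracket_def matrix_field_def differential_def vec_eq_iff)
  qed
qed

section \<open>Foliations of degree zero\<close>

lemma one_form_axis: "one_form A x (axis k 1) = A k x"
  by (simp add: one_form_def axis_def if_distrib[of "\<lambda>y. _ * y"] cong: if_cong)

lemma linear_form_one_form_left:
  assumes "\<And>k. linear_form (A k)"
  shows "linear_form (\<lambda>z. one_form A z v)"
  using linear_form_sum[of UNIV A "\<lambda>k. v $ k"] assms
  by (simp add: one_form_def mult.commute)

lemma linear_form_one_form_right: "linear_form (one_form A z)"
  using linear_form_sum[of UNIV "\<lambda>k v. v $ k" "\<lambda>k. A k z"]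
  by (simp add: one_form_def[abs_def] linear_form_coordinate)

lemma alternating_imp_antisymmetric:
  assumes "\<And>k. linear_form (A k)" and alternating: "\<And>z. one_form A z z = 0"
  shows "one_form A u v = - one_form A v u"
  using alternating[of "u + v"] alternating[of u] alternating[of v]
    linear_form_one_form_left[OF assms(1)] linear_form_one_form_right[of A]
  by (simp add: linear_form_iff add_eq_0_iff)

text \<open>
  What remains of a foliation of degree \<open>0\<close> once differentials are eliminated: a nonzero
  alternating bilinear form that satisfies the Pluecker relation.
\<close>
locale degree_zero_foliation =
  fixes A :: "'n::finite \<Rightarrow> complex^'n \<Rightarrow> complex"
  assumes homogeneous: "homogeneous_fun 1 (A k)"
    and alternating: "one_form A z z = 0"
    and pluecker: "one_form A z u * one_form A v w - one_form A z v * one_form A u w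
      + one_form A z w * one_form A u v = 0"
    and nonzero: "\<exists>p q. one_form A p q \<noteq> 0"
begin

lemma linear_coefficient: "linear_form (A k)"
  by (rule homogeneous_fun_1_imp_linear_form) (rule homogeneous)

lemmas linear_left = linear_form_one_form_left[OF linear_coefficient]

lemmas antisymmetric = alternating_imp_antisymmetric[OF linear_coefficient alternating]

lemma singular_set_radical: "singular_set A = {x. \<forall>v. one_form A x v = 0}"
proof -
  have "(\<forall>k. A k x = 0) \<longleftrightarrow> (\<forall>v. one_form A x v = 0)" for x
    using one_form_axis[of A x] by (auto simp: one_form_def)
  then show ?thesis by (simp add: singular_set_def)
qed

lemma quotient_first_integral:
  "\<exists>l1 l2. linear_form l1 \<and> linear_form l2 \<and> independent_forms l1 l2 \<and>
     first_integral_on A (\<lambda>z. l1 z / l2 z) {z. l2 z \<noteq> 0}"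
proof -
  obtain p q where pq: "one_form A p q \<noteq> 0" using nonzero by blast
  define l1 l2 where "l1 = (\<lambda>z. one_form A z p)" and "l2 = (\<lambda>z. one_form A z q)"
  have lin: "linear_form l1" "linear_form l2"
    unfolding l1_def l2_def by (rule linear_left)+
  have at_pq: "l1 p = 0" "l2 q = 0" "l2 p = one_form A p q" "l1 q = - one_form A p q"
    unfolding l1_def l2_def using antisymmetric[of q p] by (simp_all add: alternating)
  have indep: "independent_forms l1 l2"
    unfolding independent_forms_def
  proof (intro allI impI)
    fix a b assume vanish: "\<forall>z. a * l1 z + b * l2 z = 0"
    show "a = 0 \<and> b = 0"
      using spec[OF vanish, of p] spec[OF vanish, of q] pq by (simp add: at_pq)
  qed
  \<comment> \<open>The Pluecker relation at \<open>(z, u, p, q)\<close> writes \<open>\<omega>\<close> as a multiple of \<open>l1 dl2 - l2 dl1\<close>.\<close>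
  have decomposed: "one_form A z u = (l1 z * l2 u - l2 z * l1 u) / one_form A p q" for z u
    using pluecker[of z u p q] pq unfolding l1_def l2_def by (simp add: field_simps)
  have nonconst: "\<not> (\<lambda>z. l1 z / l2 z) constant_on {z. l2 z \<noteq> 0}"
  proof
    assume "(\<lambda>z. l1 z / l2 z) constant_on {z. l2 z \<noteq> 0}"
    then obtain c where c: "\<And>z. l2 z \<noteq> 0 \<Longrightarrow> l1 z / l2 z = c"
      unfolding constant_on_def by auto
    have "l1 (p + q) = - one_form A p q" "l2 (p + q) = one_form A p q"
      using lin at_pq by (simp_all add: linear_form_iff)
    then show False using c[of p] c[of "p + q"] at_pq pq by simp
  qed
  have "wedge11 (one_form A z) (differential (\<lambda>z. l1 z / l2 z) z) u v = 0"
    if "l2 z \<noteq> 0" for z u v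
  proof -
    have proportional: "one_form A z u =
        (- (l2 z)\<^sup>2 / one_form A p q) * differential (\<lambda>z. l1 z / l2 z) z u" for u
      using that
      by (simp add: differential_quotient[OF lin] decomposed[of z u] pq divide_simps)
    show ?thesis
      unfolding wedge11_def proportional[of u] proportional[of v] by simp
  qed
  then have "first_integral_on A (\<lambda>z. l1 z / l2 z) {z. l2 z \<noteq> 0}"
    unfolding first_integral_on_def
    using holomorphic_fun_on_quotient[OF lin] nonconst by blast
  with lin indep show ?thesis by blast
qed

text \<open>
  Choosing \<open>u\<close> with \<open>B(w,u) \<noteq> 0\<close>, the Pluecker relation at \<open>(w, u, v, x)\<close> shows that the
  functionals \<open>B(v,\<cdot>)\<close> and \<open>B(w,\<cdot>)\<close> are proportional whenever \<open>B(w,v) = 0\<close>.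
\<close>
lemma kernel_eq_radical_plus_radial:
  assumes "w \<notin> singular_set A" "one_form A w v = 0"
  obtains c where "v - c *s w \<in> singular_set A"
proof -
  obtain u where u: "one_form A w u \<noteq> 0"
    using assms(1) unfolding singular_set_radical by blast
  define c where "c = - one_form A u v / one_form A w u"
  have "one_form A v x = c * one_form A w x" for x
    using pluecker[of w u v x] u assms(2) unfolding c_def
    by (simp add: field_simps add_eq_0_iff)
  moreover have "one_form A (v - c *s w) x = one_form A v x - c * one_form A w x" for x
    using linear_form_line[OF linear_left, where t = "- c"] by simp
  ultimately show ?thesis using that[of c] by (simp add: singular_set_radical)
qed

definition radical_matrices :: "(complex^'n^'n) set" where
  "radical_matrices = {M. \<forall>x. M *v x \<in> singular_set A}"

lemma singular_set_subspace:
  "0 \<in> singular_set A"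
  "x \<in> singular_set A \<Longrightarrow> y \<in> singular_set A \<Longrightarrow> x + y \<in> singular_set A"
  "x \<in> singular_set A \<Longrightarrow> c *s x \<in> singular_set A"
  "x \<in> singular_set A \<Longrightarrow> y \<in> singular_set A \<Longrightarrow> x - y \<in> singular_set A"
proof -
  show 3: "x \<in> singular_set A \<Longrightarrow> c *s x \<in> singular_set A" for c x
    using linear_coefficient by (simp add: singular_set_def linear_form_iff)
  show 2: "x \<in> singular_set A \<Longrightarrow> y \<in> singular_set A \<Longrightarrow> x + y \<in> singular_set A" for x y
    using linear_coefficient by (simp add: singular_set_def linear_form_iff)
  show "0 \<in> singular_set A"
    using linear_form_line[OF linear_coefficient, of _ 0 "-1" 0] by (simp add: singular_set_def)
  show "x \<in> singular_set A \<Longrightarrow> y \<in> singular_set A \<Longrightarrow> x - y \<in> singular_set A"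
    using 2[of x "(-1) *s y"] 3[of y "-1"] by simp
qed

lemma lie_subalgebra_radical: "lie_subalgebra (matrix_field ` radical_matrices)"
proof -
  have zero: "(\<lambda>k w. 0) = matrix_field (0 :: complex^'n^'n)"
    by (simp add: fun_eq_iff matrix_field_def)
  have add: "(\<lambda>k w. matrix_field M k w + matrix_field N k w) = matrix_field (M + N)"
    for M N :: "complex^'n^'n"
    by (simp add: fun_eq_iff matrix_field_def matrix_vector_mult_add_rdistrib vec_eq_iff
        algebra_simps)
  have mat_mult: "mat c *v x = c *s x" for c and x :: "complex^'n"
    by (simp add: matrix_vector_mult_def mat_def vec_eq_iff if_distrib[of "\<lambda>y. y * _"]
        cong: if_cong)
  have scale: "(\<lambda>k w. c *s matrix_field M k w) = matrix_field (mat c ** M)"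
    for c and M :: "complex^'n^'n"
    by (simp add: fun_eq_iff matrix_field_def matrix_vector_mul_assoc[symmetric] mat_mult
        vec_eq_iff algebra_simps)
  have "0 \<in> radical_matrices"
    by (simp add: radical_matrices_def singular_set_subspace)
  moreover have "M + N \<in> radical_matrices" "N ** M - M ** N \<in> radical_matrices"
    if "M \<in> radical_matrices" "N \<in> radical_matrices" for M N
    using that
    by (simp_all add: radical_matrices_def matrix_vector_mult_add_rdistrib
        matrix_vector_mult_diff_rdistrib matrix_vector_mul_assoc[symmetric] singular_set_subspace)
  moreover have "mat c ** M \<in> radical_matrices" if "M \<in> radical_matrices" for c M
    using that
    by (simp add: radical_matrices_def matrix_vector_mul_assoc[symmetric] mat_mult
        singular_set_subspace)
  ultimately show ?thesis
    unfolding lie_subalgebra_def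
    using matrix_field_holomorphic
    by (auto simp: zero add scale lie_bracket_matrix_field)
qed

text \<open>
  A leaf direction \<open>v\<close> at \<open>w\<close> satisfies \<open>v - c w \<in> R\<close> for some \<open>c\<close>. Since \<open>w $ k = 1\<close>, the rank
  one linear field \<open>x \<mapsto> x $ k (v - c w)\<close> takes the value \<open>v - c w\<close> at \<open>w\<close>, and the projection
  onto the tangent space of the chart, which contains \<open>v\<close>, brings it back to \<open>v\<close>.
\<close>
lemma matrix_fields_span_leaf:
  assumes w: "w $ k = 1" "w \<notin> singular_set A"
  shows "{X k w | X. X \<in> matrix_field ` radical_matrices} = leaf_tangent_space A k w"
proof (intro equalityI subsetI)
  fix v assume "v \<in> {X k w | X. X \<in> matrix_field ` radical_matrices}"
  then obtain M where M: "M \<in> radical_matrices" and v: "v = matrix_field M k w" by blast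
  have "one_form A w (M *v w) = 0"
    using M antisymmetric[of w "M *v w"] by (simp add: radical_matrices_def singular_set_radical)
  then have "one_form A w v = 0"
    using linear_form_line[OF linear_form_one_form_right, of A w "M *v w" "- (M *v w) $ k" w] w(1)
    by (simp add: v matrix_field_def alternating)
  moreover have "v $ k = 0" using w(1) by (simp add: v matrix_field_def)
  ultimately show "v \<in> leaf_tangent_space A k w" by (simp add: leaf_tangent_space_def)
next
  fix v assume "v \<in> leaf_tangent_space A k w"
  then have v: "v $ k = 0" "one_form A w v = 0" by (simp_all add: leaf_tangent_space_def)
  obtain c where c: "v - c *s w \<in> singular_set A"
    using kernel_eq_radical_plus_radial[OF w(2) v(2)] .
  define M :: "complex^'n^'n" where "M = (\<chi> i j. if j = k then (v - c *s w) $ i else 0)"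
  have M: "M *v x = x $ k *s (v - c *s w)" for x
    by (simp add: M_def matrix_vector_mult_def vec_eq_iff if_distrib[of "\<lambda>y. y * _"]
        cong: if_cong, simp add: algebra_simps)
  have "M *v x \<in> singular_set A" for x
    unfolding M by (rule singular_set_subspace(3)[OF c])
  then have "M \<in> radical_matrices" by (simp add: radical_matrices_def)
  moreover have "matrix_field M k w = v"
    using w(1) v(1) by (simp add: matrix_field_def M)
  ultimately show "v \<in> {X k w | X. X \<in> matrix_field ` radical_matrices}" by blast
qed

text \<open>
  The generic set is the complement of \<open>R\<close>; being a cone, \<open>R\<close> is respected by the passage
  from \<open>z\<close> to its representative in a chart.
\<close>
lemma radical_L_foliation: "L_foliation A"
proof -
  have closed: "projective_closed (singular_set A)"
    unfolding projective_closed_def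
    by (intro exI[of _ "range A"])
      (use homogeneous in \<open>auto simp: zero_locus_def singular_set_def\<close>)
  obtain p where p: "p \<notin> singular_set A"
    using nonzero by (auto simp: singular_set_radical)
  then have "p \<noteq> 0" using singular_set_subspace(1) by auto
  have span: "{X k (to_chart k z) | X. X \<in> matrix_field ` radical_matrices}
      = leaf_tangent_space A k (to_chart k z)"
    if z: "z \<notin> singular_set A" "z $ k \<noteq> 0" for z k
  proof (rule matrix_fields_span_leaf)
    show "to_chart k z $ k = 1" using z(2) by (simp add: to_chart_def)
    have "z = z $ k *s to_chart k z" using z(2) by (simp add: to_chart_def)
    then show "to_chart k z \<notin> singular_set A" using singular_set_subspace(3) z(1) by metis
  qed
  show ?thesis
    unfolding L_foliation_def for_generic_point_def
    using lie_subalgebra_radical closed p \<open>p \<noteq> 0\<close> span by blast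
qed

end

text \<open>
  For a form with linear coefficients, \<open>d\<omega>(u,v) = B(u,v) - B(v,u) = 2B(u,v)\<close> is constant in
  \<open>z\<close>, so that integrability is the Pluecker relation up to the factor \<open>2\<close>. If \<open>B\<close> vanished,
  the singular set would have codimension \<open>0\<close>.
\<close>
lemma codim_one_foliation_degree_zero:
  fixes A :: "'n::finite \<Rightarrow> complex^'n \<Rightarrow> complex"
  assumes fol: "codim_one_foliation 0 A"
  shows "degree_zero_foliation A"
proof -
  have hom: "homogeneous_fun 1 (A k)" for k
    using fol by (simp add: codim_one_foliation_def)
  have alt: "one_form A z z = 0" for z
    using fol by (simp add: codim_one_foliation_def one_form_def mult.commute)
  have lin: "linear_form (A k)" for k
    using hom by (rule homogeneous_fun_1_imp_linear_form)
  note left = linear_form_one_form_left[OF lin]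
  note anti = alternating_imp_antisymmetric[OF lin alt]
  have ext: "ext_deriv (one_form A) z u v = 2 * one_form A u v" for z u v
    by (simp add: ext_deriv_def differential_linear_form[OF left] anti[of v u])
  have "wedge12 (one_form A z) (ext_deriv (one_form A) z) u v w
      = 2 * (one_form A z u * one_form A v w - one_form A z v * one_form A u w
        + one_form A z w * one_form A u v)" for z u v w
    unfolding wedge12_def ext by (simp add: algebra_simps)
  moreover have "wedge12 (one_form A z) (ext_deriv (one_form A) z) u v w = 0" for z u v w
    using fol unfolding codim_one_foliation_def by blast
  ultimately have plu: "one_form A z u * one_form A v w - one_form A z v * one_form A u w
      + one_form A z w * one_form A u v = 0" for z u v w
    by (metis mult_eq_0_iff zero_neq_numeral)
  have "singular_set A \<noteq> UNIV"
    using fol codimension_UNIV[where 'n = 'n] by (auto simp: codim_one_foliation_def)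
  then obtain p k where pk: "A k p \<noteq> 0" by (auto simp: singular_set_def)
  then have "\<exists>p q. one_form A p q \<noteq> 0" by (metis one_form_axis)
  with hom alt plu show ?thesis unfolding degree_zero_foliation_def by blast
qed

theorem proposition3p1:
  fixes A :: "'n::finite \<Rightarrow> complex^'n \<Rightarrow> complex"
  assumes "codim_one_foliation 0 A"
  shows "(\<exists>l1 l2. linear_form l1 \<and> linear_form l2 \<and> independent_forms l1 l2 \<and>
            first_integral_on A (\<lambda>z. l1 z / l2 z) {z. l2 z \<noteq> 0}) \<and>
         L_foliation A"
proof -
  interpret degree_zero_foliation A
    using assms by (rule codim_one_foliation_degree_zero)
  show ?thesis using quotient_first_integral radical_L_foliation by blast
qed

end
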